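(* For every $0<c\leq 1$, there exist a probability space $(X,\mathcal{X},\mu)$, with two commuting invertible measure preserving transformations $T_1,T_2$ such that $(X,\mathcal{X},\mu,T_1,T_2)$ is ergodic, and a measurable set $A\in\mathcal{X}$ with $\mu(A)>0$, such that $$\mu(A\cap T_1^nA\cap T_2^nA)<c\,\mu(A)^3$$ for every integer $n\neq 0$.
   Context: $(X,\mathcal{X},\mu,T_1,T_2)$ is ergodic if every measurable set invariant under both $T_1$ and $T_2$ has measure $0$ or $1$ (ergodicity of the joint $\mathbb{Z}^2$-action). *)

theory Defs
  imports "HOL-Probability.Probability"
begin

definition invertible_measure_preserving :: "'a measure \<Rightarrow> ('a \<Rightarrow> 'a) \<Rightarrow> bool" where
  "invertible_measure_preserving M T \<longleftrightarrow>
     bij_betw T (space M) (space M) \<and>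
     T \<in> M \<rightarrow>\<^sub>M M \<and>
     inv_into (space M) T \<in> M \<rightarrow>\<^sub>M M \<and>
     distr M M T = M"

definition commute_on_space :: "'a measure \<Rightarrow> ('a \<Rightarrow> 'a) \<Rightarrow> ('a \<Rightarrow> 'a) \<Rightarrow> bool" where
  "commute_on_space M T S \<longleftrightarrow> (\<forall>x\<in>space M. T (S x) = S (T x))"

(* Integer iterates of a bijection of space M. The values outside space M are irrelevant. *)
definition int_iterate :: "'a measure \<Rightarrow> ('a \<Rightarrow> 'a) \<Rightarrow> int \<Rightarrow> 'a \<Rightarrow> 'a" where
  "int_iterate M T n =
     (if 0 \<le> n then T ^^ nat n else (inv_into (space M) T) ^^ nat (- n))"

definition invariant_set :: "'a measure \<Rightarrow> ('a \<Rightarrow> 'a) \<Rightarrow> 'a set \<Rightarrow> bool" where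
  "invariant_set M T B \<longleftrightarrow> T -` B \<inter> space M = B"

(* Ergodicity of the joint action: neither transformation needs to be ergodic by itself. *)
definition jointly_ergodic :: "'a measure \<Rightarrow> ('a \<Rightarrow> 'a) \<Rightarrow> ('a \<Rightarrow> 'a) \<Rightarrow> bool" where
  "jointly_ergodic M T S \<longleftrightarrow>
     (\<forall>B\<in>sets M. invariant_set M T B \<and> invariant_set M S B \<longrightarrow>
        measure M B = 0 \<or> measure M B = 1)"

end

theory Submission
  imports Defs
begin

text \<open>
  Take three independent two-sided Bernoulli shifts \<open>x, y, z\<close> on the alphabet of \<open>m\<close> bits, and let
  \<open>T\<^sub>1 = id \<times> S \<times> S\<close> and \<open>T\<^sub>2 = S \<times> id \<times> S\<close>. The composition \<open>T\<^sub>1 T\<^sub>2 = S \<times> S \<times> S\<^sup>2\<close> is mixing, so the joint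
  action is ergodic. For a set \<open>A = {(x\<^sub>0, y\<^sub>0, z\<^sub>0) \<in> B}\<close> and \<open>n \<noteq> 0\<close>, independence turns the measure of the
  triple intersection into the probability that \<open>(x, y, z)\<close>, \<open>(x, y', z')\<close> and \<open>(x', y, z')\<close> all lie
  in \<open>B\<close> for independent uniform entries. For \<open>m = 1\<close> and \<open>B\<close> the six non-constant triples of bits
  this is \<open>26/64\<close>, whereas \<open>(6/8)\<^sup>3 = 27/64\<close>. Both sides are multiplicative under products, so requiring
  the condition in each of the \<open>m\<close> bits makes the ratio \<open>(26/27)\<^sup>m\<close>, which is eventually below \<open>c\<close>.
  As there are only continuum many configurations, the system can be copied to the reals.
\<close>

section \<open>Fair coin measures\<close>

definition fair_coins :: "('i \<Rightarrow> bool) measure" where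
  "fair_coins = (\<Pi>\<^sub>M i\<in>UNIV. measure_pmf (bernoulli_pmf (1/2)))"

lemma space_fair_coins [simp]: "space fair_coins = UNIV"
  by (auto simp: fair_coins_def space_PiM)

interpretation fair_coins: prob_space "fair_coins :: ('i \<Rightarrow> bool) measure"
  unfolding fair_coins_def by (intro prob_space_PiM measure_pmf.prob_space_axioms)

lemma measurable_reindex_fair_coins: "(\<lambda>w. w \<circ> p) \<in> fair_coins \<rightarrow>\<^sub>M fair_coins"
  unfolding fair_coins_def o_def by (rule measurable_PiM_single') (auto simp: space_PiM)

text \<open>Injectivity makes the coins \<open>w (p i)\<close> pairwise distinct, hence again
  independent and fair.\<close>

lemma distr_reindex_fair_coins:
  assumes "inj p"
  shows "distr fair_coins fair_coins (\<lambda>w. w \<circ> p) = fair_coins"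
  using distr_PiM_reindex[of UNIV "\<lambda>_. measure_pmf (bernoulli_pmf (1/2))" p UNIV] assms
  by (simp add: fair_coins_def measure_pmf.prob_space_axioms o_def restrict_def)

lemma ex_map_eq:
  assumes "distinct ks" and "length vs = length ks"
  obtains w where "map w ks = vs"
proof
  show "map (\<lambda>k. the (map_of (zip ks vs) k)) ks = vs"
    using assms by (intro nth_equalityI) (auto simp: map_of_zip_nth)
qed

lemma fair_coins_singleton_cylinder:
  fixes ks :: "'i list"
  assumes "distinct ks" and "length vs = length ks"
  shows "{w. map w ks = vs} \<in> sets fair_coins"
    and "measure fair_coins {w. map w ks = vs} = (1/2) ^ length ks"
proof -
  interpret product_prob_space "\<lambda>_. measure_pmf (bernoulli_pmf (1/2))" "UNIV :: 'i set"
    by standard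
  obtain u where u: "map u ks = vs"
    using ex_map_eq assms by blast
  have eq: "{w. map w ks = vs} = {w \<in> space fair_coins. \<forall>i\<in>set ks. w i \<in> {u i}}"
    using u by auto
  show "{w. map w ks = vs} \<in> sets fair_coins"
    unfolding eq unfolding fair_coins_def
    by (intro sets.sets_Collect_finite_All sets_Collect_single') auto
  have "emeasure fair_coins {w. map w ks = vs} = (\<Prod>i\<in>set ks. emeasure (measure_pmf (bernoulli_pmf (1/2))) {u i})"
    unfolding eq unfolding fair_coins_def by (rule emeasure_PiM_Collect) auto
  also have "emeasure (measure_pmf (bernoulli_pmf (1/2))) {b} = ennreal (1/2)" for b
    by (cases b) (auto simp: emeasure_pmf_single)
  then have "(\<Prod>i\<in>set ks. emeasure (measure_pmf (bernoulli_pmf (1/2))) {u i}) = ennreal ((1/2) ^ length ks)"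
    using assms(1) by (simp only: prod_constant distinct_card) (simp only: ennreal_power)
  finally show "measure fair_coins {w. map w ks = vs} = (1/2) ^ length ks"
    by (simp add: measure_def)
qed

lemma fair_coins_cylinder:
  assumes "distinct ks" and V: "V \<subseteq> {vs. length vs = length ks}"
  shows "{w. map w ks \<in> V} \<in> sets fair_coins"
    and "measure fair_coins {w. map w ks \<in> V} = card V / 2 ^ length ks"
proof -
  have "finite {vs :: bool list. length vs = length ks}"
    using finite_lists_length_eq[of "UNIV :: bool set" "length ks"] by simp
  then have fin: "finite V"
    using V finite_subset by blast
  have eq: "{w. map w ks \<in> V} = (\<Union>vs\<in>V. {w. map w ks = vs})"
    by auto
  show "{w. map w ks \<in> V} \<in> sets fair_coins"
    unfolding eq using fair_coins_singleton_cylinder(1)[OF assms(1)] V fin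
    by (intro sets.finite_UN) auto
  have "measure fair_coins {w. map w ks \<in> V} = (\<Sum>vs\<in>V. measure fair_coins {w. map w ks = vs})"
    unfolding eq using fair_coins_singleton_cylinder(1)[OF assms(1)] V fin
    by (intro fair_coins.finite_measure_finite_Union) (auto simp: disjoint_family_on_def)
  also have "\<dots> = (\<Sum>vs\<in>V. (1/2) ^ length ks)"
    using fair_coins_singleton_cylinder(2)[OF assms(1)] V by (intro sum.cong) auto
  finally show "measure fair_coins {w. map w ks \<in> V} = card V / 2 ^ length ks"
    by (simp add: power_one_over)
qed

text \<open>Distinctness of the concatenation makes the blocks disjoint, hence independent. Since
  all blocks have length \<open>n\<close>, a concatenation determines its pieces, so the admissible
  patterns number \<open>card V ^ length bs\<close>. This is the source of the exponent
  \<open>m\<close> in the final estimate.\<close>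

lemma fair_coins_blocks:
  assumes dist: "distinct (concat bs)" and len: "\<forall>b\<in>set bs. length b = n"
    and V: "V \<subseteq> {vs. length vs = n}"
  shows "{w. \<forall>b\<in>set bs. map w b \<in> V} \<in> sets fair_coins"
    and "measure fair_coins {w. \<forall>b\<in>set bs. map w b \<in> V} = (card V / 2 ^ n) ^ length bs"
proof -
  define Vs where "Vs = {vss. set vss \<subseteq> V \<and> length vss = length bs}"
  have len_concat: "length (concat xss) = length xss * n" if "\<forall>xs\<in>set xss. length xs = n"
    for xss :: "'x list list"
    using that by (induction xss) auto
  have concat_eq: "concat xss = concat yss \<longleftrightarrow> xss = yss"
    if "\<forall>xs\<in>set xss. length xs = n" "\<forall>ys\<in>set yss. length ys = n" "length xss = length yss"
    for xss yss :: "bool list list"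
  proof (rule concat_eq_concat_iff)
    show "\<forall>(xs, ys)\<in>set (zip xss yss). length xs = length ys"
      using that(1,2) by (metis (mono_tags, lifting) case_prodI2 set_zip_leftD set_zip_rightD)
  qed (rule that(3))
  have eq: "{w. \<forall>b\<in>set bs. map w b \<in> V} = {w. map w (concat bs) \<in> concat ` Vs}"
  proof safe
    fix w assume "\<forall>b\<in>set bs. map w b \<in> V"
    then show "map w (concat bs) \<in> concat ` Vs"
      by (intro image_eqI[of _ _ "map (map w) bs"]) (auto simp: Vs_def map_concat)
  next
    fix w vss b assume w: "map w (concat bs) = concat vss" "vss \<in> Vs" "b \<in> set bs"
    then have "concat (map (map w) bs) = concat vss"
      by (simp add: map_concat)
    then have "map (map w) bs = vss"
      using w V len by (subst (asm) concat_eq) (auto simp: Vs_def)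
    then show "map w b \<in> V"
      using w by (auto simp: Vs_def)
  qed
  have sub: "concat ` Vs \<subseteq> {vs. length vs = length (concat bs)}"
    using V len by (auto simp: Vs_def len_concat subset_iff)
  have "inj_on concat Vs"
    using V by (intro inj_onI) (subst (asm) concat_eq, auto simp: Vs_def)
  moreover have "finite V"
    using V finite_lists_length_eq[of "UNIV :: bool set" n] finite_subset by auto
  ultimately have "card (concat ` Vs) = card V ^ length bs"
    unfolding Vs_def by (simp add: card_image card_lists_length_eq)
  then show "measure fair_coins {w. \<forall>b\<in>set bs. map w b \<in> V} = (card V / 2 ^ n) ^ length bs"
    unfolding eq using fair_coins_cylinder(2)[OF dist sub] len
    by (simp add: len_concat power_divide mult.commute flip: power_mult)
  show "{w. \<forall>b\<in>set bs. map w b \<in> V} \<in> sets fair_coins"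
    unfolding eq by (rule fair_coins_cylinder(1)[OF dist sub])
qed

section \<open>Events depending on finitely many coins\<close>

definition depends_on :: "'i set \<Rightarrow> ('i \<Rightarrow> bool) set \<Rightarrow> bool" where
  "depends_on K D \<longleftrightarrow> (\<forall>w w'. (\<forall>k\<in>K. w k = w' k) \<longrightarrow> (w \<in> D \<longleftrightarrow> w' \<in> D))"

lemma depends_on_mono: "depends_on K D \<Longrightarrow> K \<subseteq> L \<Longrightarrow> depends_on L D"
  unfolding depends_on_def by blast

lemma depends_on_Compl: "depends_on K D \<Longrightarrow> depends_on K (- D)"
  unfolding depends_on_def by blast

lemma depends_on_UN: "(\<And>i. i \<in> I \<Longrightarrow> depends_on K (D i)) \<Longrightarrow> depends_on K (\<Union>i\<in>I. D i)"
  unfolding depends_on_def by blast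

lemma depends_on_reindex:
  assumes "depends_on K D"
  shows "depends_on (p ` K) ((\<lambda>w. w \<circ> p) -` D)"
  unfolding depends_on_def vimage_eq
proof (intro allI impI)
  fix w w' :: "'b \<Rightarrow> bool" assume "\<forall>k\<in>p ` K. w k = w' k"
  then have "\<forall>k\<in>K. (w \<circ> p) k = (w' \<circ> p) k"
    by simp
  then show "(w \<circ> p \<in> D) = (w' \<circ> p \<in> D)"
    using assms unfolding depends_on_def by blast
qed

lemma depends_on_cylinder:
  assumes "depends_on (set ks) D"
  shows "D = {w. map w ks \<in> (\<lambda>w. map w ks) ` D}"
proof (intro set_eqI iffI CollectI imageI)
  fix w assume "w \<in> {w. map w ks \<in> (\<lambda>w. map w ks) ` D}"
  then obtain u where "u \<in> D" "\<forall>k\<in>set ks. u k = w k"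
    by auto
  then show "w \<in> D"
    using assms unfolding depends_on_def by blast
qed

lemma sets_depends_on:
  assumes "finite K" "depends_on K D"
  shows "D \<in> sets fair_coins"
proof -
  obtain ks where "set ks = K" "distinct ks"
    using finite_distinct_list assms(1) by blast
  then have "D = {w. map w ks \<in> (\<lambda>w. map w ks) ` D}"
    using depends_on_cylinder assms(2) by blast
  moreover have "{w. map w ks \<in> (\<lambda>w. map w ks) ` D} \<in> sets fair_coins"
    using \<open>distinct ks\<close> by (intro fair_coins_cylinder(1)) auto
  ultimately show ?thesis
    by simp
qed

text \<open>The patterns on \<open>ks @ ls\<close> that lie in both events are the concatenations of
  a pattern for \<open>D\<close> and one for \<open>E\<close>, so the counts multiply.\<close>

lemma indep_depends_on:
  assumes fin: "finite K" "finite L" and disj: "K \<inter> L = {}"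
    and dep: "depends_on K D" "depends_on L E"
  shows "measure fair_coins (D \<inter> E) = measure fair_coins D * measure fair_coins E"
proof -
  obtain ks ls where ks: "set ks = K" "distinct ks" and ls: "set ls = L" "distinct ls"
    using finite_distinct_list fin by metis
  define V W where "V = (\<lambda>w. map w ks) ` D" and "W = (\<lambda>w. map w ls) ` E"
  define VW where "VW = (\<lambda>(v, w). v @ w) ` (V \<times> W)"
  have DE: "D = {w. map w ks \<in> V}" "E = {w. map w ls \<in> W}"
    unfolding V_def W_def using depends_on_cylinder dep ks(1) ls(1) by blast+
  have V: "V \<subseteq> {vs. length vs = length ks}" and W: "W \<subseteq> {vs. length vs = length ls}"
    by (auto simp: V_def W_def)
  have eq: "D \<inter> E = {w. map w (ks @ ls) \<in> VW}"
  proof safe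
    fix w assume "w \<in> D" "w \<in> E"
    then show "map w (ks @ ls) \<in> VW"
      unfolding VW_def by (intro image_eqI[of _ _ "(map w ks, map w ls)"]) (auto simp: DE)
  next
    fix w assume "map w (ks @ ls) \<in> VW"
    then obtain v u where "map w ks @ map w ls = v @ u" "v \<in> V" "u \<in> W"
      by (auto simp: VW_def)
    moreover from this have "length v = length (map w ks)"
      using V by auto
    ultimately show "w \<in> D" "w \<in> E"
      by (auto simp: DE)
  qed
  have "inj_on (\<lambda>(v, w). v @ w) (V \<times> W)"
    using V by (auto intro!: inj_onI simp: subset_iff)
  then have "card VW = card V * card W"
    unfolding VW_def by (simp add: card_image card_cartesian_product)
  moreover have "measure fair_coins (D \<inter> E) = card VW / 2 ^ length (ks @ ls)"
    unfolding eq using ks ls disj V W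
    by (intro fair_coins_cylinder(2)) (auto simp: VW_def subset_iff)
  moreover have "measure fair_coins D = card V / 2 ^ length ks"
    unfolding DE using ks V by (intro fair_coins_cylinder(2))
  moreover have "measure fair_coins E = card W / 2 ^ length ls"
    unfolding DE using ls W by (intro fair_coins_cylinder(2))
  ultimately show ?thesis
    by (simp add: power_add)
qed

text \<open>The events that can be approximated to every precision contain the one-coin events and
  are closed under complements and countable unions, so induction over the generated sigma-algebra
  reaches every \<open>B\<close>.\<close>

lemma fair_coins_approx:
  fixes B :: "('i \<Rightarrow> bool) set"
  assumes "B \<in> sets fair_coins" and "0 < e"
  obtains K D where "finite K" "depends_on K D" "measure fair_coins (sym_diff B D) < e"
proof -
  define G :: "('i \<Rightarrow> bool) set set"
    where "G = {{f \<in> \<Pi>\<^sub>E i\<in>UNIV. UNIV. f i \<in> A} | i A. True}"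
  have sets_eq: "sets (fair_coins :: ('i \<Rightarrow> bool) measure) = sigma_sets UNIV G"
    unfolding fair_coins_def sets_PiM_single G_def by simp
  have "B \<in> sigma_sets UNIV G"
    using assms sets_eq by simp
  then have "\<forall>e>0. \<exists>K D. finite K \<and> depends_on K D \<and> measure fair_coins (sym_diff B D) < e"
  proof (induction rule: sigma_sets.induct)
    case (Basic a)
    then obtain i A where a: "a = {f. f i \<in> A}"
      by (auto simp: G_def)
    have "depends_on {i} a"
      by (auto simp: depends_on_def a)
    then show ?case
      by (intro allI impI exI[of _ "{i}"] exI[of _ a]) auto
  next
    case Empty
    have "depends_on {} ({} :: ('i \<Rightarrow> bool) set)"
      by (auto simp: depends_on_def)
    then show ?case
      by (intro allI impI exI[of _ "{}"]) auto
  next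
    case (Compl a)
    have "sym_diff (UNIV - a) (- D) = sym_diff a D" for D :: "('i \<Rightarrow> bool) set"
      by auto
    then show ?case
      using Compl.IH depends_on_Compl by metis
  next
    case (Union a)
    have a_sets [measurable]: "a n \<in> sets fair_coins" for n
      using Union.hyps sets_eq by simp
    show ?case
    proof (intro allI impI)
      fix e :: real assume e: "0 < e"
      \<comment> \<open>Continuity from below: finitely many of the \<open>a n\<close> fill the
        union up to \<open>e / 2\<close>.\<close>
      have "(\<lambda>N. measure fair_coins (\<Union>n<N. a n)) \<longlonglongrightarrow> measure fair_coins (\<Union>N. \<Union>n<N. a n)"
        by (intro fair_coins.finite_Lim_measure_incseq)
          (auto simp: incseq_def intro: order.strict_trans2)
      moreover have "(\<Union>N. \<Union>n<N. a n) = (\<Union>n. a n)"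
        by auto
      ultimately have "eventually (\<lambda>N. measure fair_coins (\<Union>n. a n) - e / 2
          < measure fair_coins (\<Union>n<N. a n)) sequentially"
        using e by (intro order_tendstoD(1)) auto
      then obtain N where N: "measure fair_coins (\<Union>n. a n) - e / 2 < measure fair_coins (\<Union>n<N. a n)"
        by (auto simp: eventually_sequentially)
      \<comment> \<open>The \<open>N\<close> approximation errors then add up to at most
        \<open>e / 2\<close>; \<open>Suc\<close> keeps the tolerance positive for
        \<open>N = 0\<close>.\<close>
      have "\<exists>K D. finite K \<and> depends_on K D \<and> measure fair_coins (sym_diff (a n) D) < e / (2 * Suc N)" for n
        using Union.IH[of n] e by simp
      then obtain K D where KD: "finite (K n)" "depends_on (K n) (D n)"
          "measure fair_coins (sym_diff (a n) (D n)) < e / (2 * Suc N)" for n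
        by metis
      have D_sets [measurable]: "D n \<in> sets fair_coins" for n
        using sets_depends_on KD by blast
      have "measure fair_coins (sym_diff (\<Union>n. a n) (\<Union>n<N. D n))
          \<le> measure fair_coins (((\<Union>n. a n) - (\<Union>n<N. a n)) \<union> (\<Union>n<N. sym_diff (a n) (D n)))"
        by (intro fair_coins.finite_measure_mono) auto
      also have "\<dots> \<le> measure fair_coins ((\<Union>n. a n) - (\<Union>n<N. a n))
          + measure fair_coins (\<Union>n<N. sym_diff (a n) (D n))"
        by (intro measure_Un_le) auto
      also have "measure fair_coins ((\<Union>n. a n) - (\<Union>n<N. a n))
          = measure fair_coins (\<Union>n. a n) - measure fair_coins (\<Union>n<N. a n)"
        by (intro fair_coins.finite_measure_Diff) auto
      also have "measure fair_coins (\<Union>n<N. sym_diff (a n) (D n))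
          \<le> (\<Sum>n<N. measure fair_coins (sym_diff (a n) (D n)))"
        by (intro measure_UNION_le) auto
      also have "\<dots> \<le> (\<Sum>n<N. e / (2 * Suc N))"
        using KD(3) by (intro sum_mono) (simp add: less_imp_le)
      also have "\<dots> \<le> e / 2"
        using e by (simp add: field_simps)
      finally have "measure fair_coins (sym_diff (\<Union>n. a n) (\<Union>n<N. D n)) < e"
        using N by simp
      moreover have "depends_on (\<Union>n<N. K n) (\<Union>n<N. D n)"
        using KD(2) by (intro depends_on_UN depends_on_mono[OF KD(2)]) auto
      moreover have "finite (\<Union>n<N. K n)"
        using KD(1) by simp
      ultimately show "\<exists>K D. finite K \<and> depends_on K D \<and>
          measure fair_coins (sym_diff (\<Union> (range a)) D) < e"
        by blast
    qed
  qed
  then show ?thesis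
    using that assms(2) by blast
qed

section \<open>A zero-one law by approximation\<close>

lemma (in prob_space) abs_measure_diff_le:
  assumes "S \<in> events" "T \<in> events"
  shows "\<bar>prob S - prob T\<bar> \<le> prob (sym_diff S T)"
proof -
  have "prob S \<le> prob (T \<union> sym_diff S T)" "prob T \<le> prob (S \<union> sym_diff S T)"
    using assms by (auto intro!: finite_measure_mono)
  moreover have "prob (T \<union> sym_diff S T) \<le> prob T + prob (sym_diff S T)"
      "prob (S \<union> sym_diff S T) \<le> prob S + prob (sym_diff S T)"
    using assms by (auto intro!: measure_Un_le)
  ultimately show ?thesis
    by linarith
qed

text \<open>
  Approximating \<open>B\<close> by an event \<open>D\<close> on the coins \<open>K\<close>, the events \<open>D\<close> and \<open>(\<lambda>w. w \<circ> p) -` D\<close> are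
  independent and both close to \<open>B\<close>, whence \<open>measure B = (measure B)\<^sup>2\<close>.
\<close>
lemma fair_coins_zero_one:
  assumes B: "B \<in> sets fair_coins"
    and inv: "\<And>K :: 'i set. finite K \<Longrightarrow> \<exists>p. inj p \<and> p ` K \<inter> K = {} \<and> (\<lambda>w. w \<circ> p) -` B = B"
  shows "measure fair_coins B = 0 \<or> measure fair_coins B = 1"
proof -
  let ?P = "measure (fair_coins :: ('i \<Rightarrow> bool) measure)"
  have "\<bar>?P B - (?P B)\<^sup>2\<bar> \<le> 0 + e" if e: "0 < e" for e
  proof -
    \<comment> \<open>With tolerance \<open>e / 4\<close>, passing from \<open>B\<close> to
      \<open>D \<inter> D'\<close> costs less than \<open>e / 2\<close>, and passing from
      \<open>(?P B)\<^sup>2\<close> to \<open>(?P D)\<^sup>2\<close> at most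
      \<open>e / 2\<close>.\<close>
    obtain K D where KD: "finite K" "depends_on K D" "?P (sym_diff B D) < e / 4"
      using fair_coins_approx[OF B, of "e / 4"] e by auto
    obtain p where p: "inj p" "p ` K \<inter> K = {}" "(\<lambda>w. w \<circ> p) -` B = B"
      using inv[OF KD(1)] by blast
    define D' where "D' = (\<lambda>w. w \<circ> p) -` D"
    have D: "D \<in> sets fair_coins"
      using sets_depends_on KD by blast
    have pres: "?P ((\<lambda>w. w \<circ> p) -` S) = ?P S" if "S \<in> sets fair_coins" for S
      using measure_distr[OF measurable_reindex_fair_coins that, of p]
      by (simp add: distr_reindex_fair_coins[OF p(1)])
    have D': "D' \<in> sets fair_coins"
      using measurable_sets[OF measurable_reindex_fair_coins D, of p] by (simp add: D'_def)
    \<comment> \<open>As \<open>B\<close> is its own preimage, the error of \<open>D'\<close> is the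
      preimage of the error of \<open>D\<close> and has the same measure.\<close>
    have "(\<lambda>w. w \<circ> p) -` sym_diff B D = sym_diff B D'"
      using p(3) by (auto simp: D'_def)
    then have BD': "?P (sym_diff B D') < e / 4"
      using pres[of "sym_diff B D"] KD(3) B D by simp
    have "?P (sym_diff B (D \<inter> D')) \<le> ?P (sym_diff B D \<union> sym_diff B D')"
      using B D D' by (intro fair_coins.finite_measure_mono) auto
    also have "\<dots> \<le> ?P (sym_diff B D) + ?P (sym_diff B D')"
      using B D D' by (intro measure_Un_le) auto
    finally have "\<bar>?P B - ?P (D \<inter> D')\<bar> < e / 2"
      using fair_coins.abs_measure_diff_le[of B "D \<inter> D'"] B D D' KD(3) BD' by simp
    moreover have "?P (D \<inter> D') = (?P D)\<^sup>2"
      using indep_depends_on[OF KD(1) finite_imageI[OF KD(1)] _ KD(2) depends_on_reindex[OF KD(2)], of p]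
        p(2) pres[OF D] by (simp add: D'_def Int_commute power2_eq_square)
    moreover have "\<bar>(?P B)\<^sup>2 - (?P D)\<^sup>2\<bar> \<le> e / 2"
    proof -
      have "\<bar>(?P B)\<^sup>2 - (?P D)\<^sup>2\<bar> = \<bar>?P B - ?P D\<bar> * (?P B + ?P D)"
        by (simp add: power2_eq_square square_diff_square_factored abs_mult mult.commute)
      also have "\<dots> \<le> e / 4 * 2"
        using fair_coins.abs_measure_diff_le[of B D] B D KD(3) e
          add_mono[OF fair_coins.prob_le_1[of B] fair_coins.prob_le_1[of D]]
        by (intro mult_mono) auto
      finally show ?thesis
        by simp
    qed
    ultimately show ?thesis
      by linarith
  qed
  then have "\<bar>?P B - (?P B)\<^sup>2\<bar> \<le> 0"
    by (rule field_le_epsilon)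
  then have "?P B * (1 - ?P B) = 0"
    by (simp add: power2_eq_square algebra_simps)
  then show ?thesis
    by auto
qed

section \<open>Shifts\<close>

text \<open>Each \<open>j\<close> labels one two-sided Bernoulli sequence and \<open>d j\<close> is
  its speed, so products such as \<open>id \<times> S \<times> S\<close> and all their integer
  powers have this form.\<close>

definition coin_shift :: "('j \<Rightarrow> int) \<Rightarrow> (int \<times> 'j \<Rightarrow> bool) \<Rightarrow> int \<times> 'j \<Rightarrow> bool" where
  "coin_shift d w = w \<circ> (\<lambda>(k, j). (k + d j, j))"

lemma inj_translation: "inj (\<lambda>(k, j). (k + d j :: int, j))"
  by (auto intro!: injI)

lemma coin_shift_apply [simp]: "coin_shift d w (k, j) = w (k + d j, j)"
  by (simp add: coin_shift_def)

lemma coin_shift_compose: "coin_shift a (coin_shift b w) = coin_shift (\<lambda>j. a j + b j) w"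
  by (auto simp: add.assoc)

lemma coin_shift_0 [simp]: "coin_shift (\<lambda>j. 0) = id"
  by (auto simp: fun_eq_iff)

lemma coin_shift_uminus [simp]: "coin_shift (\<lambda>j. - d j) (coin_shift d w) = w" "coin_shift d (coin_shift (\<lambda>j. - d j) w) = w"
  by (simp_all add: coin_shift_compose)

lemma inv_coin_shift: "inv (coin_shift d) = coin_shift (\<lambda>j. - d j)"
  by (rule inv_equality) simp_all

lemma bij_coin_shift: "bij (coin_shift d)"
  by (rule bij_betw_byWitness[of _ "coin_shift (\<lambda>j. - d j)"]) auto

lemma coin_shift_image: "coin_shift d ` A = coin_shift (\<lambda>j. - d j) -` A"
  using bij_image_Collect_eq[OF bij_coin_shift, of d "\<lambda>w. w \<in> A"] by (auto simp: inv_coin_shift)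

lemma measurable_coin_shift: "coin_shift d \<in> fair_coins \<rightarrow>\<^sub>M fair_coins"
  using measurable_reindex_fair_coins unfolding coin_shift_def[abs_def] .

lemma distr_coin_shift: "distr fair_coins fair_coins (coin_shift d) = fair_coins"
  unfolding coin_shift_def[abs_def] by (rule distr_reindex_fair_coins[OF inj_translation])

lemma invertible_measure_preserving_coin_shift: "invertible_measure_preserving fair_coins (coin_shift d)"
  by (simp add: invertible_measure_preserving_def bij_coin_shift inv_coin_shift measurable_coin_shift distr_coin_shift)

lemma coin_shift_funpow: "coin_shift d ^^ n = coin_shift (\<lambda>j. int n * d j)"
  by (induction n) (auto simp: coin_shift_compose fun_eq_iff algebra_simps)

lemma int_iterate_coin_shift: "int_iterate fair_coins (coin_shift d) n = coin_shift (\<lambda>j. n * d j)"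
  by (auto simp: int_iterate_def inv_coin_shift coin_shift_funpow)

text \<open>
  Only the composition of the two shifts is used: it moves every coin, so its iterates push any
  finite set of coins off itself.
\<close>
lemma jointly_ergodic_coin_shift:
  fixes a b :: "'j \<Rightarrow> int"
  assumes pos: "\<And>j. 0 < a j + b j"
  shows "jointly_ergodic fair_coins (coin_shift a) (coin_shift b)"
  unfolding jointly_ergodic_def
proof (intro ballI impI fair_coins_zero_one)
  fix B and K :: "(int \<times> 'j) set"
  assume inv: "invariant_set fair_coins (coin_shift a) B \<and> invariant_set fair_coins (coin_shift b) B"
    and "finite K"
  define d where "d = (\<lambda>j. a j + b j)"
  have "coin_shift d -` B = coin_shift b -` (coin_shift a -` B)"
    by (auto simp: coin_shift_compose d_def add.commute)
  then have "coin_shift d -` B = B"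
    using inv by (simp add: invariant_set_def)
  then have B: "(coin_shift d ^^ n) -` B = B" for n
    by (induction n) (simp_all add: vimage_comp flip: funpow_Suc_right, simp flip: vimage_comp)
  define N where "N = nat (\<Sum>x\<in>K. \<bar>fst x\<bar>)"
  have N: "\<bar>k\<bar> \<le> int N" if "(k, j) \<in> K" for k j
    using member_le_sum[of "(k, j)" K "\<lambda>x. \<bar>fst x\<bar>"] \<open>finite K\<close> that by (simp add: N_def sum_nonneg)
  \<comment> \<open>Two times in \<open>[-N, N]\<close> differ by at most \<open>2 * N\<close>,
    whereas \<open>n\<close> steps move every coin by at least \<open>n\<close>, because
    \<open>d j \<ge> 1\<close>.\<close>
  define n where "n = 2 * N + 1"
  define p where "p = (\<lambda>(k, j :: 'j). (k + int n * d j, j))"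
  have "(k + int n * d j, j) \<notin> K" if "(k, j) \<in> K" for k j
  proof
    assume "(k + int n * d j, j) \<in> K"
    then have "\<bar>k + int n * d j\<bar> \<le> int N" "\<bar>k\<bar> \<le> int N"
      using N that by blast+
    moreover have "int n \<le> int n * d j"
      using pos[of j] by (simp add: d_def mult_le_cancel_left1)
    ultimately show False
      unfolding n_def by linarith
  qed
  then have "p ` K \<inter> K = {}"
    by (auto simp: p_def)
  moreover have "(\<lambda>w. w \<circ> p) -` B = B"
    using B[of n] unfolding coin_shift_funpow unfolding coin_shift_def[abs_def] p_def .
  moreover have "inj p"
    unfolding p_def by (rule inj_translation)
  ultimately show "\<exists>p. inj p \<and> p ` K \<inter> K = {} \<and> (\<lambda>w. w \<circ> p) -` B = B"
    by blast
qed

section \<open>Systems on other carriers\<close>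

text \<open>The copy of \<open>T\<close> on \<open>range f\<close>, which contains the space of
  \<open>embed_measure M f\<close>; elsewhere \<open>inv f\<close> is unspecified.\<close>

definition conjugate :: "('a \<Rightarrow> 'b) \<Rightarrow> ('a \<Rightarrow> 'a) \<Rightarrow> 'b \<Rightarrow> 'b" where
  "conjugate f T x = f (T (inv f x))"

context
  fixes f :: "'a \<Rightarrow> 'b"
  assumes inj: "inj f"
begin

lemma conjugate_apply [simp]: "conjugate f T (f x) = f (T x)"
  by (simp add: conjugate_def inj)

lemma measurable_conjugate:
  assumes "T \<in> M \<rightarrow>\<^sub>M M"
  shows "conjugate f T \<in> embed_measure M f \<rightarrow>\<^sub>M embed_measure M f"
  using measurable_comp[OF assms measurable_embed_measure2[OF inj]]
  by (intro measurable_embed_measure1) (simp add: o_def)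

lemma bij_betw_conjugate:
  assumes "bij_betw T S S"
  shows "bij_betw (conjugate f T) (f ` S) (f ` S)"
proof (rule bij_betw_imageI)
  show "inj_on (conjugate f T) (f ` S)"
    using bij_betw_imp_inj_on[OF assms] inj by (auto simp: inj_on_def)
  have "conjugate f T ` f ` S = f ` T ` S"
    by (simp add: image_image)
  then show "conjugate f T ` f ` S = f ` S"
    using bij_betw_imp_surj_on[OF assms] by simp
qed

lemma inv_into_conjugate:
  assumes "bij_betw T S S" "x \<in> S"
  shows "inv_into (f ` S) (conjugate f T) (f x) = f (inv_into S T x)"
proof (rule inv_into_f_eq)
  show "inj_on (conjugate f T) (f ` S)"
    using bij_betw_conjugate[OF assms(1)] bij_betw_imp_inj_on by blast
  show "f (inv_into S T x) \<in> f ` S"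
    using assms by (simp add: bij_betw_imp_surj_on inv_into_into)
  show "conjugate f T (f (inv_into S T x)) = f x"
    using assms by (simp add: bij_betw_inv_into_right)
qed

lemma invertible_measure_preserving_conjugate:
  assumes "invertible_measure_preserving M T"
  shows "invertible_measure_preserving (embed_measure M f) (conjugate f T)"
proof -
  let ?N = "embed_measure M f"
  have T: "bij_betw T (space M) (space M)" "T \<in> M \<rightarrow>\<^sub>M M"
      "inv_into (space M) T \<in> M \<rightarrow>\<^sub>M M" "distr M M T = M"
    using assms by (auto simp: invertible_measure_preserving_def)
  note f = measurable_embed_measure2[OF inj, of M]
  have N: "?N = distr M ?N f"
    by (rule embed_measure_eq_distr[OF inj])
  have "conjugate f (inv_into (space M) T) \<in> ?N \<rightarrow>\<^sub>M ?N"
    by (rule measurable_conjugate[OF T(3)])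
  \<comment> \<open>The inverse of the copy agrees with the copy of the inverse on
    \<open>space ?N\<close>, which suffices for measurability.\<close>
  then have "inv_into (space ?N) (conjugate f T) \<in> ?N \<rightarrow>\<^sub>M ?N"
    by (rule measurable_cong[THEN iffD1, rotated])
      (auto simp: space_embed_measure inv_into_conjugate[OF T(1)])
  moreover have "distr ?N ?N (conjugate f T) = ?N"
  proof -
    have "distr ?N ?N (conjugate f T) = distr (distr M ?N f) ?N (conjugate f T)"
      using N by simp
    also have "\<dots> = distr M ?N (conjugate f T \<circ> f)"
      by (rule distr_distr[OF measurable_conjugate[OF T(2)] f])
    also have "conjugate f T \<circ> f = f \<circ> T"
      by auto
    also have "distr M ?N (f \<circ> T) = distr (distr M M T) ?N f"
      by (rule distr_distr[OF f T(2), symmetric])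
    finally show ?thesis
      using T(4) N by simp
  qed
  ultimately show ?thesis
    using bij_betw_conjugate[OF T(1)] measurable_conjugate[OF T(2)]
    by (simp add: invertible_measure_preserving_def space_embed_measure)
qed

lemma commute_on_space_conjugate:
  "commute_on_space M T S \<Longrightarrow> commute_on_space (embed_measure M f) (conjugate f T) (conjugate f S)"
  by (auto simp: commute_on_space_def space_embed_measure)

lemma jointly_ergodic_conjugate:
  assumes "jointly_ergodic M T S"
  shows "jointly_ergodic (embed_measure M f) (conjugate f T) (conjugate f S)"
  unfolding jointly_ergodic_def
proof (intro ballI impI)
  fix B assume "B \<in> sets (embed_measure M f)"
    and inv: "invariant_set (embed_measure M f) (conjugate f T) B \<and>
      invariant_set (embed_measure M f) (conjugate f S) B"
  then obtain B' where B': "B = f ` B'" "B' \<in> sets M"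
    by (auto simp: sets_embed_measure[OF inj])
  have pull: "invariant_set M R B'" if "invariant_set (embed_measure M f) (conjugate f R) B" for R
  proof -
    \<comment> \<open>Injectivity of \<open>f\<close> allows the invariance equation to be pulled
      back to \<open>M\<close>.\<close>
    have "f -` (conjugate f R -` f ` B' \<inter> f ` space M) = f -` f ` B'"
      using that by (simp add: invariant_set_def space_embed_measure B'(1))
    moreover have "f -` (conjugate f R -` f ` B' \<inter> f ` space M) = R -` B' \<inter> space M"
      using inj by (auto simp: inj_eq)
    ultimately show ?thesis
      by (simp add: invariant_set_def inj_vimage_image_eq[OF inj])
  qed
  have "measure (embed_measure M f) B = measure M B'"
    using B' by (simp add: measure_def emeasure_embed_measure_image[OF inj])
  then show "measure (embed_measure M f) B = 0 \<or> measure (embed_measure M f) B = 1"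
    using assms B'(2) inv pull by (simp add: jointly_ergodic_def)
qed

lemma funpow_conjugate: "(conjugate f T ^^ n) (f x) = f ((T ^^ n) x)"
  by (induction n) auto

lemma int_iterate_conjugate:
  assumes bij: "bij_betw T (space M) (space M)" and x: "x \<in> space M"
  shows "int_iterate (embed_measure M f) (conjugate f T) n (f x) = f (int_iterate M T n x)"
proof -
  \<comment> \<open>The induction also carries that the orbit stays in \<open>space M\<close>, where
    \<open>inv_into_conjugate\<close> applies.\<close>
  have "(inv_into (f ` space M) (conjugate f T) ^^ k) (f x) = f ((inv_into (space M) T ^^ k) x) \<and>
      (inv_into (space M) T ^^ k) x \<in> space M" for k
    using x bij
    by (induction k) (auto simp: inv_into_conjugate bij_betw_imp_surj_on intro: inv_into_into)
  then show ?thesis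
    by (simp add: int_iterate_def funpow_conjugate space_embed_measure)
qed

end

lemma conjugate_system:
  fixes f :: "'a \<Rightarrow> 'b"
  assumes f: "inj f" and M: "prob_space M"
    and T: "invertible_measure_preserving M T\<^sub>1" "invertible_measure_preserving M T\<^sub>2"
    and A: "A \<in> sets M"
  defines "N \<equiv> embed_measure M f"
  shows "prob_space N" "f ` A \<in> sets N" "measure N (f ` A) = measure M A"
    "measure N (f ` A \<inter> int_iterate N (conjugate f T\<^sub>1) n ` f ` A \<inter> int_iterate N (conjugate f T\<^sub>2) n ` f ` A)
      = measure M (A \<inter> int_iterate M T\<^sub>1 n ` A \<inter> int_iterate M T\<^sub>2 n ` A)"
proof -
  have N: "N = distr M N f"
    unfolding N_def by (rule embed_measure_eq_distr[OF f])
  show "prob_space N"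
    by (subst N, rule prob_space.prob_space_distr[OF M])
      (simp add: N_def measurable_embed_measure2[OF f])
  show "f ` A \<in> sets N"
    unfolding N_def by (rule in_sets_embed_measure[OF A])
  \<comment> \<open>For nonmeasurable \<open>S\<close> both sides take the default value 0, so the
    equation can be applied to the triple intersection directly.\<close>
  have meas: "measure N (f ` S) = measure M S" for S
  proof (cases "S \<in> sets M")
    case True
    then show ?thesis
      by (simp add: N_def measure_def emeasure_embed_measure_image[OF f])
  next
    case False
    then have "f ` S \<notin> sets N"
      by (auto simp: N_def sets_embed_measure[OF f] inj_image_eq_iff[OF f])
    with False show ?thesis
      by (simp add: measure_notin_sets)
  qed
  then show "measure N (f ` A) = measure M A" .
  have "int_iterate N (conjugate f T) n ` f ` A = f ` int_iterate M T n ` A"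
    if "invertible_measure_preserving M T" for T
    using int_iterate_conjugate[OF f, of T M] that sets.sets_into_space[OF A]
    by (auto simp: N_def invertible_measure_preserving_def image_image intro!: image_cong)
  then show "measure N (f ` A \<inter> int_iterate N (conjugate f T\<^sub>1) n ` f ` A \<inter> int_iterate N (conjugate f T\<^sub>2) n ` f ` A)
      = measure M (A \<inter> int_iterate M T\<^sub>1 n ` A \<inter> int_iterate M T\<^sub>2 n ` A)"
    using T by (simp add: meas flip: image_Int[OF f])
qed

section \<open>The set with small triple intersections\<close>

definition not_all_equal :: "bool list \<Rightarrow> bool" where
  "not_all_equal vs \<longleftrightarrow> \<not> (vs ! 0 = vs ! 1 \<and> vs ! 1 = vs ! 2)"

lemma card_not_all_equal:
  "card {vs. length vs = 3 \<and> not_all_equal vs} = 6"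
proof -
  have "{vs. length vs = 3 \<and> not_all_equal vs} = set (filter not_all_equal (List.n_lists 3 [True, False]))"
    by (auto simp: set_n_lists)
  \<comment> \<open>Removing duplicates turns the cardinality into the length of a list, which can
    be evaluated.\<close>
  also have "\<dots> = set (remdups (filter not_all_equal (List.n_lists 3 [True, False])))"
    by simp
  also have "card \<dots> = length (remdups (filter not_all_equal (List.n_lists 3 [True, False])))"
    by (rule distinct_card) simp
  also have "\<dots> = 6"
    by code_simp
  finally show ?thesis .
qed

text \<open>
  The entries are \<open>[x, y, z, x', y', z']\<close>: the first transformation fixes \<open>x\<close>, the second
  fixes \<open>y\<close>, and both move \<open>z\<close> to the same \<open>z'\<close>.
\<close>
definition corner :: "bool list \<Rightarrow> bool" where
  "corner vs \<longleftrightarrow> not_all_equal [vs ! 0, vs ! 1, vs ! 2] \<and>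
     not_all_equal [vs ! 0, vs ! 4, vs ! 5] \<and> not_all_equal [vs ! 3, vs ! 1, vs ! 5]"

text \<open>Inclusion-exclusion explains the value: \<open>64 - 3 * 16 + 3 * 4 - 2\<close>. Two of
  the triples share one entry and are both constant in 4 lists, just as if independent; only the
  last term, 2 instead of 1, brings the count below 27. The proof enumerates all 64 lists.\<close>

lemma card_corner: "card {vs. length vs = 6 \<and> corner vs} = 26"
proof -
  have "{vs. length vs = 6 \<and> corner vs} = set (filter corner (List.n_lists 6 [True, False]))"
    by (auto simp: set_n_lists)
  also have "\<dots> = set (remdups (filter corner (List.n_lists 6 [True, False])))"
    by simp
  also have "card \<dots> = length (remdups (filter corner (List.n_lists 6 [True, False])))"
    by (rule distinct_card) simp
  also have "\<dots> = 26"
    by code_simp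
  finally show ?thesis .
qed

text \<open>
  Coins are indexed by time, coordinate (0, 1, 2 for \<open>x\<close>, \<open>y\<close>, \<open>z\<close>) and bit position; those outside
  the three coordinates and the first \<open>m\<close> bits exist but never matter.
\<close>
definition block :: "nat \<Rightarrow> int \<Rightarrow> (int \<times> nat \<times> nat) list" where
  "block i k = [(k, 0, i), (k, 1, i), (k, 2, i)]"

text \<open>The set \<open>A\<close> before it is copied to the reals; it looks at the coins at time
  0.\<close>

definition no_constant_block :: "nat \<Rightarrow> (int \<times> nat \<times> nat \<Rightarrow> bool) set" where
  "no_constant_block m = {w. \<forall>i<m. not_all_equal (map w (block i 0))}"

lemma distinct_concat_blocks: "distinct (concat (map (\<lambda>i. block i 0) [0..<m]))"
  by (induction m) (auto simp: block_def)

text \<open>Here \<open>n \<noteq> 0\<close> enters the estimate: for \<open>t = 0\<close> the two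
  blocks would coincide.\<close>

lemma distinct_concat_double_blocks:
  assumes "t \<noteq> 0"
  shows "distinct (concat (map (\<lambda>i. block i 0 @ block i t) [0..<m]))"
  using assms by (induction m) (auto simp: block_def)

lemma no_constant_block_eq: "no_constant_block m =
  {w. \<forall>b\<in>set (map (\<lambda>i. block i 0) [0..<m]). map w b \<in> {vs. length vs = 3 \<and> not_all_equal vs}}"
  by (auto simp: no_constant_block_def block_def)

lemma sets_no_constant_block: "no_constant_block m \<in> sets fair_coins"
  unfolding no_constant_block_eq
  by (rule fair_coins_blocks(1)[OF distinct_concat_blocks, where n = 3]) (auto simp: block_def)

lemma measure_no_constant_block: "measure fair_coins (no_constant_block m) = (3/4) ^ m"
proof -
  have "measure fair_coins (no_constant_block m)
      = (card {vs. length vs = 3 \<and> not_all_equal vs} / 2 ^ 3) ^ length (map (\<lambda>i. block i 0) [0..<m])"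
    unfolding no_constant_block_eq
    by (rule fair_coins_blocks(2)[OF distinct_concat_blocks, where n = 3]) (auto simp: block_def)
  then show ?thesis
    by (simp add: card_not_all_equal)
qed

text \<open>\<open>step 0\<close> and \<open>step 1\<close> are the speeds of
  \<open>T\<^sub>1\<close> and \<open>T\<^sub>2\<close>. They never vanish together, as joint
  ergodicity requires of the composition.\<close>

definition step :: "nat \<Rightarrow> nat \<times> nat \<Rightarrow> int" where
  "step a j = (if fst j = a then 0 else 1)"

lemma measure_no_constant_block_corner:
  assumes "n \<noteq> 0"
  shows "measure fair_coins (no_constant_block m \<inter> int_iterate fair_coins (coin_shift (step 0)) n ` no_constant_block m
      \<inter> int_iterate fair_coins (coin_shift (step 1)) n ` no_constant_block m) = (13/32) ^ m"
proof -
  \<comment> \<open>An image under the \<open>n\<close>-th iterate is a preimage under the opposite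
    shift, so the moved coordinates are read at time \<open>- n\<close>.\<close>
  have "no_constant_block m \<inter> int_iterate fair_coins (coin_shift (step 0)) n ` no_constant_block m
      \<inter> int_iterate fair_coins (coin_shift (step 1)) n ` no_constant_block m =
    {w. \<forall>b\<in>set (map (\<lambda>i. block i 0 @ block i (- n)) [0..<m]). map w b \<in> {vs. length vs = 6 \<and> corner vs}}"
    by (auto simp: int_iterate_coin_shift coin_shift_image no_constant_block_def block_def step_def
        corner_def not_all_equal_def)
  then have "measure fair_coins (no_constant_block m \<inter> int_iterate fair_coins (coin_shift (step 0)) n ` no_constant_block m
      \<inter> int_iterate fair_coins (coin_shift (step 1)) n ` no_constant_block m)
      = (card {vs. length vs = 6 \<and> corner vs} / 2 ^ 6) ^ length (map (\<lambda>i. block i 0 @ block i (- n)) [0..<m])"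
    by (simp only:) (rule fair_coins_blocks(2)[OF distinct_concat_double_blocks, where n = 6];
      use assms in \<open>auto simp: block_def\<close>)
  then show ?thesis
    by (simp add: card_corner)
qed

text \<open>Through \<open>to_nat\<close> a configuration becomes a set of naturals, and there are
  as many of those as reals.\<close>

lemma ex_inj_real:
  obtains f :: "('i :: countable \<Rightarrow> bool) \<Rightarrow> real" where "inj f"
proof -
  obtain g :: "nat set \<Rightarrow> real" where g: "inj g"
    using nat_sets_eqpoll_reals unfolding eqpoll_def bij_betw_def by blast
  have "inj (\<lambda>w :: 'i \<Rightarrow> bool. to_nat ` Collect w)"
    by (rule injI) (simp add: inj_image_eq_iff Collect_inj)
  then show thesis
    using that inj_compose[OF g] by blast
qed

theorem theorem1p2:
  fixes c :: real
  assumes "0 < c" and "c \<le> 1"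
  shows "\<exists>(M :: real measure) T\<^sub>1 T\<^sub>2 A.
     prob_space M \<and>
     invertible_measure_preserving M T\<^sub>1 \<and>
     invertible_measure_preserving M T\<^sub>2 \<and>
     commute_on_space M T\<^sub>1 T\<^sub>2 \<and>
     jointly_ergodic M T\<^sub>1 T\<^sub>2 \<and>
     A \<in> sets M \<and>
     measure M A > 0 \<and>
     (\<forall>n::int. n \<noteq> 0 \<longrightarrow>
        measure M (A \<inter> int_iterate M T\<^sub>1 n ` A \<inter> int_iterate M T\<^sub>2 n ` A) < c * measure M A ^ 3)"
proof -
  obtain f :: "(int \<times> nat \<times> nat \<Rightarrow> bool) \<Rightarrow> real" where f: "inj f"
    by (rule ex_inj_real)
  obtain m where m: "(26/27 :: real) ^ m < c"
    using real_arch_pow_inv[OF assms(1), of "26/27"] by auto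
  let ?T = "\<lambda>a. coin_shift (step a)"
  note sys = conjugate_system[OF f fair_coins.prob_space_axioms invertible_measure_preserving_coin_shift
      invertible_measure_preserving_coin_shift sets_no_constant_block]
  have "(13/32) ^ m < c * ((3/4) ^ m) ^ 3"
  proof -
    \<comment> \<open>For a single bit, \<open>13/32 = 26/27 * 27/64\<close>.\<close>
    have "(13/32 :: real) ^ m = (26/27) ^ m * ((3/4) ^ 3) ^ m"
      by (simp flip: power_mult_distrib add: power3_eq_cube)
    also have "\<dots> = (26/27) ^ m * ((3/4) ^ m) ^ 3"
      by (simp only: power_mult[symmetric] mult.commute)
    also have "\<dots> < c * ((3/4) ^ m) ^ 3"
      using m by simp
    finally show ?thesis .
  qed
  moreover have "commute_on_space fair_coins (?T 0) (?T 1)"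
    by (simp add: commute_on_space_def coin_shift_compose add.commute)
  moreover have "jointly_ergodic fair_coins (?T 0) (?T 1)"
    by (rule jointly_ergodic_coin_shift) (simp add: step_def)
  ultimately show ?thesis
    by (intro exI[of _ "embed_measure fair_coins f"] exI[of _ "conjugate f (?T 0)"]
        exI[of _ "conjugate f (?T 1)"] exI[of _ "f ` no_constant_block m"])
      (simp add: sys measure_no_constant_block measure_no_constant_block_corner invertible_measure_preserving_conjugate[OF f]
        invertible_measure_preserving_coin_shift commute_on_space_conjugate[OF f]
        jointly_ergodic_conjugate[OF f] flip: One_nat_def)
qed

end
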